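(* Let $P$ be a quasi-lattice ordered subsemigroup of a group $Q$ and $\Lambda$ an $(r,d)$-proper topological $P$-graph. Let $\Omega$ be its path space and $T$ the shift: $\Omega*P=\{(A,n)\in\Omega\times P: A\cdot n\neq\emptyset\}$, $T(A,n)=A\cdot n$. Then $T$ is a directed action of $P$ on $\Omega$ by partial local homeomorphisms.
   Context: $P\subset Q$ subsemigroup, $m\le n$ iff $n=mp$ with $p\in P$; quasi-lattice ordered: $P\cap P^{-1}=\{e\}$ and two elements with a common upper bound have a least upper bound. Topological $P$-graph: small category $\Lambda$ with vertex set $\Lambda^{(0)}\subset\Lambda$, $r,s:\Lambda\to\Lambda^{(0)}$, composition on $\Lambda^{(2)}=\{(\lambda,\mu):s(\lambda)=r(\mu)\}$; $\Lambda,\Lambda^{(0)}$ locally compact Hausdorff, $r,s$ continuous, $s$ a local homeomorphism, inclusion of vertices continuous, composition continuous and open; continuous degree map $d:\Lambda\to P$ ($P$ discrete) with $d(\lambda\mu)=d(\lambda)d(\mu)$, $d(v)=e$ on vertices, and composition $\Lambda^m*\Lambda^n\to\Lambda^{mn}$ a homeomorphism ($\Lambda^m=d^{-1}(m)$). $(r,d)$-proper: $(r,d):\Lambda\to\Lambda^{(0)}\times P$ is proper. $\mu\le\lambda$ iff $\lambda=\mu\nu$. A subset is hereditary if closed under $\le$-predecessors and directed if any two elements have a common upper bound inside it. The path space $\Omega$ is the set of nonempty closed hereditary directed subsets of $\Lambda$ with the relative Fell topology (basic open sets $\{F:F\cap K=\emptyset, F\cap U_i\ne\emptyset\}$, $K$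 compact, $U_i$ open). $A\cdot n=\{\nu:\exists\mu\in\Lambda^n, \mu\nu\in A\}$. For a partial action, $U(n)=\{A:(A,n)\in\Omega*P\}$, $V(n)=\{A\cdot n\}$, $T_n(A)=A\cdot n$; "by partial local homeomorphisms" means each $U(n),V(n)$ is open and $T_n:U(n)\to V(n)$ is a local homeomorphism; directed means whenever $U(m)\cap U(n)\neq\emptyset$ there is $r\ge m,n$ in $P$ with $U(m)\cap U(n)=U(r)$. A partial action satisfies $A\cdot e=A$ and $(A,mn)\in\Omega*P$ iff $(A,m),(A\cdot m,n)\in\Omega*P$ with $(A\cdot m)\cdot n=A\cdot(mn)$. *)

theory Defs
  imports "HOL-Analysis.Analysis" "HOL-Algebra.Group"
begin

definition qle :: "('q, 'z) monoid_scheme \<Rightarrow> 'q set \<Rightarrow> 'q \<Rightarrow> 'q \<Rightarrow> bool" where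
  "qle Q P m n \<longleftrightarrow> (\<exists>p\<in>P. n = m \<otimes>\<^bsub>Q\<^esub> p)"

definition subsemigroup :: "('q, 'z) monoid_scheme \<Rightarrow> 'q set \<Rightarrow> bool" where
  "subsemigroup Q P \<longleftrightarrow> P \<subseteq> carrier Q \<and> (\<forall>m\<in>P. \<forall>n\<in>P. m \<otimes>\<^bsub>Q\<^esub> n \<in> P)"

definition quasi_lattice_ordered :: "('q, 'z) monoid_scheme \<Rightarrow> 'q set \<Rightarrow> bool" where
  "quasi_lattice_ordered Q P \<longleftrightarrow>
     group Q \<and> subsemigroup Q P \<and>
     {p \<in> P. inv\<^bsub>Q\<^esub> p \<in> P} = {\<one>\<^bsub>Q\<^esub>} \<and>
     (\<forall>m\<in>P. \<forall>n\<in>P. (\<exists>k\<in>P. qle Q P m k \<and> qle Q P n k) \<longrightarrow>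
        (\<exists>l\<in>P. qle Q P m l \<and> qle Q P n l \<and>
                (\<forall>k\<in>P. qle Q P m k \<and> qle Q P n k \<longrightarrow> qle Q P l k)))"

definition local_homeomorphism :: "'a topology \<Rightarrow> 'b topology \<Rightarrow> ('a \<Rightarrow> 'b) \<Rightarrow> bool" where
  "local_homeomorphism X Y f \<longleftrightarrow>
     f ` topspace X \<subseteq> topspace Y \<and>
     (\<forall>x\<in>topspace X. \<exists>U. openin X U \<and> x \<in> U \<and> openin Y (f ` U) \<and>
        homeomorphic_map (subtopology X U) (subtopology Y (f ` U)) f)"

definition lch_space :: "'a topology \<Rightarrow> bool" where
  "lch_space X \<longleftrightarrow> locally_compact_space X \<and> Hausdorff_space X"

text \<open>L is the topology on the morphism set \<Lambda> = topspace L, V the topology on the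
  vertex set \<Lambda>0 = topspace V (a subset of \<Lambda>); r, s range, source; c composition; d degree.\<close>

definition composable :: "'a topology \<Rightarrow> ('a \<Rightarrow> 'a) \<Rightarrow> ('a \<Rightarrow> 'a) \<Rightarrow> ('a \<times> 'a) set" where
  "composable L r s = {(x, y). x \<in> topspace L \<and> y \<in> topspace L \<and> s x = r y}"

definition degree_set :: "'a topology \<Rightarrow> ('a \<Rightarrow> 'q) \<Rightarrow> 'q \<Rightarrow> 'a set" where
  "degree_set L d n = {x \<in> topspace L. d x = n}"

definition topological_P_graph ::
  "('q, 'z) monoid_scheme \<Rightarrow> 'q set \<Rightarrow> 'a topology \<Rightarrow> 'a topology \<Rightarrow>
   ('a \<Rightarrow> 'a) \<Rightarrow> ('a \<Rightarrow> 'a) \<Rightarrow> ('a \<Rightarrow> 'a \<Rightarrow> 'a) \<Rightarrow> ('a \<Rightarrow> 'q) \<Rightarrow> bool" where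
  "topological_P_graph Q P L V r s c d \<longleftrightarrow>
     \<comment> \<open>small category with vertex set topspace V \<subseteq> topspace L\<close>
     topspace V \<subseteq> topspace L \<and>
     (\<forall>x\<in>topspace L. r x \<in> topspace V \<and> s x \<in> topspace V) \<and>
     (\<forall>v\<in>topspace V. r v = v \<and> s v = v) \<and>
     (\<forall>x\<in>topspace L. c (r x) x = x \<and> c x (s x) = x) \<and>
     (\<forall>(x, y)\<in>composable L r s. c x y \<in> topspace L \<and> r (c x y) = r x \<and> s (c x y) = s y) \<and>
     (\<forall>x\<in>topspace L. \<forall>y\<in>topspace L. \<forall>z\<in>topspace L. s x = r y \<and> s y = r z \<longrightarrow>
        c (c x y) z = c x (c y z)) \<and>
     \<comment> \<open>topology\<close>
     lch_space L \<and> lch_space V \<and>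
     continuous_map L V r \<and> continuous_map L V s \<and> local_homeomorphism L V s \<and>
     continuous_map V L id \<and>
     continuous_map (subtopology (prod_topology L L) (composable L r s)) L (\<lambda>(x, y). c x y) \<and>
     open_map (subtopology (prod_topology L L) (composable L r s)) L (\<lambda>(x, y). c x y) \<and>
     \<comment> \<open>degree map\<close>
     continuous_map L (discrete_topology P) d \<and>
     (\<forall>(x, y)\<in>composable L r s. d (c x y) = d x \<otimes>\<^bsub>Q\<^esub> d y) \<and>
     (\<forall>v\<in>topspace V. d v = \<one>\<^bsub>Q\<^esub>) \<and>
     (\<forall>m\<in>P. \<forall>n\<in>P.
        homeomorphic_map
          (subtopology (prod_topology L L)
             {(x, y)\<in>composable L r s. d x = m \<and> d y = n})
          (subtopology L (degree_set L d (m \<otimes>\<^bsub>Q\<^esub> n)))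
          (\<lambda>(x, y). c x y))"

definition rd_proper ::
  "'q set \<Rightarrow> 'a topology \<Rightarrow> 'a topology \<Rightarrow> ('a \<Rightarrow> 'a) \<Rightarrow> ('a \<Rightarrow> 'q) \<Rightarrow> bool" where
  "rd_proper P L V r d \<longleftrightarrow> proper_map L (prod_topology V (discrete_topology P)) (\<lambda>x. (r x, d x))"

definition path_le :: "'a topology \<Rightarrow> ('a \<Rightarrow> 'a) \<Rightarrow> ('a \<Rightarrow> 'a) \<Rightarrow> ('a \<Rightarrow> 'a \<Rightarrow> 'a) \<Rightarrow> 'a \<Rightarrow> 'a \<Rightarrow> bool" where
  "path_le L r s c x y \<longleftrightarrow> x \<in> topspace L \<and> (\<exists>z\<in>topspace L. s x = r z \<and> y = c x z)"

definition hereditary :: "'a topology \<Rightarrow> ('a \<Rightarrow> 'a) \<Rightarrow> ('a \<Rightarrow> 'a) \<Rightarrow> ('a \<Rightarrow> 'a \<Rightarrow> 'a) \<Rightarrow> 'a set \<Rightarrow> bool" where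
  "hereditary L r s c A \<longleftrightarrow> (\<forall>y\<in>A. \<forall>x. path_le L r s c x y \<longrightarrow> x \<in> A)"

definition directed_set :: "'a topology \<Rightarrow> ('a \<Rightarrow> 'a) \<Rightarrow> ('a \<Rightarrow> 'a) \<Rightarrow> ('a \<Rightarrow> 'a \<Rightarrow> 'a) \<Rightarrow> 'a set \<Rightarrow> bool" where
  "directed_set L r s c A \<longleftrightarrow>
     (\<forall>x\<in>A. \<forall>y\<in>A. \<exists>z\<in>A. path_le L r s c x z \<and> path_le L r s c y z)"

definition path_space :: "'a topology \<Rightarrow> ('a \<Rightarrow> 'a) \<Rightarrow> ('a \<Rightarrow> 'a) \<Rightarrow> ('a \<Rightarrow> 'a \<Rightarrow> 'a) \<Rightarrow> 'a set set" where
  "path_space L r s c =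
     {A. A \<noteq> {} \<and> closedin L A \<and> hereditary L r s c A \<and> directed_set L r s c A}"

text \<open>Relative Fell topology on the path space: generated by the subbasic sets
  {F. F \<inter> K = {}} (K compact) and {F. F \<inter> U \<noteq> {}} (U open), intersected with the path space.
  (Finite intersections of these are exactly the basic Fell-open sets.)\<close>
definition path_topology :: "'a topology \<Rightarrow> ('a \<Rightarrow> 'a) \<Rightarrow> ('a \<Rightarrow> 'a) \<Rightarrow> ('a \<Rightarrow> 'a \<Rightarrow> 'a) \<Rightarrow> 'a set topology" where
  "path_topology L r s c =
     topology_generated_by
       ({{F \<in> path_space L r s c. F \<inter> K = {}} | K. compactin L K} \<union>
        {{F \<in> path_space L r s c. F \<inter> U \<noteq> {}} | U. openin L U})"

definition shift :: "'a topology \<Rightarrow> ('a \<Rightarrow> 'a) \<Rightarrow> ('a \<Rightarrow> 'a) \<Rightarrow> ('a \<Rightarrow> 'a \<Rightarrow> 'a) \<Rightarrow> ('a \<Rightarrow> 'q) \<Rightarrow>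
    'a set \<Rightarrow> 'q \<Rightarrow> 'a set" where
  "shift L r s c d A n =
     {y \<in> topspace L. \<exists>x\<in>topspace L. d x = n \<and> s x = r y \<and> c x y \<in> A}"

definition shift_domain :: "'q set \<Rightarrow> 'a topology \<Rightarrow> ('a \<Rightarrow> 'a) \<Rightarrow> ('a \<Rightarrow> 'a) \<Rightarrow> ('a \<Rightarrow> 'a \<Rightarrow> 'a) \<Rightarrow>
    ('a \<Rightarrow> 'q) \<Rightarrow> ('a set \<times> 'q) set" where
  "shift_domain P L r s c d = {(A, n). A \<in> path_space L r s c \<and> n \<in> P \<and> shift L r s c d A n \<noteq> {}}"

definition partial_action ::
  "('q, 'z) monoid_scheme \<Rightarrow> 'q set \<Rightarrow> 'x topology \<Rightarrow> ('x \<times> 'q) set \<Rightarrow> ('x \<Rightarrow> 'q \<Rightarrow> 'x) \<Rightarrow> bool" where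
  "partial_action Q P X D T \<longleftrightarrow>
     D \<subseteq> topspace X \<times> P \<and>
     (\<forall>(A, n)\<in>D. T A n \<in> topspace X) \<and>
     (\<forall>A\<in>topspace X. (A, \<one>\<^bsub>Q\<^esub>) \<in> D \<and> T A \<one>\<^bsub>Q\<^esub> = A) \<and>
     (\<forall>A\<in>topspace X. \<forall>m\<in>P. \<forall>n\<in>P.
        ((A, m \<otimes>\<^bsub>Q\<^esub> n) \<in> D \<longleftrightarrow> (A, m) \<in> D \<and> (T A m, n) \<in> D) \<and>
        ((A, m \<otimes>\<^bsub>Q\<^esub> n) \<in> D \<longrightarrow> T (T A m) n = T A (m \<otimes>\<^bsub>Q\<^esub> n)))"

definition act_U :: "'x topology \<Rightarrow> ('x \<times> 'q) set \<Rightarrow> 'q \<Rightarrow> 'x set" where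
  "act_U X D n = {A \<in> topspace X. (A, n) \<in> D}"

definition act_V :: "'x topology \<Rightarrow> ('x \<times> 'q) set \<Rightarrow> ('x \<Rightarrow> 'q \<Rightarrow> 'x) \<Rightarrow> 'q \<Rightarrow> 'x set" where
  "act_V X D T n = (\<lambda>A. T A n) ` act_U X D n"

definition by_partial_local_homeomorphisms ::
  "'q set \<Rightarrow> 'x topology \<Rightarrow> ('x \<times> 'q) set \<Rightarrow> ('x \<Rightarrow> 'q \<Rightarrow> 'x) \<Rightarrow> bool" where
  "by_partial_local_homeomorphisms P X D T \<longleftrightarrow>
     (\<forall>n\<in>P. openin X (act_U X D n) \<and> openin X (act_V X D T n) \<and>
        local_homeomorphism (subtopology X (act_U X D n)) (subtopology X (act_V X D T n))
          (\<lambda>A. T A n))"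

definition directed_action ::
  "('q, 'z) monoid_scheme \<Rightarrow> 'q set \<Rightarrow> 'x topology \<Rightarrow> ('x \<times> 'q) set \<Rightarrow> bool" where
  "directed_action Q P X D \<longleftrightarrow>
     (\<forall>m\<in>P. \<forall>n\<in>P. act_U X D m \<inter> act_U X D n \<noteq> {} \<longrightarrow>
        (\<exists>k\<in>P. qle Q P m k \<and> qle Q P n k \<and> act_U X D m \<inter> act_U X D n = act_U X D k))"

end

theory Submission
  imports Defs
begin

text \<open>By unique factorisation a path contains at most one arrow of each degree, so
  \<open>A \<cdot> n\<close> is nonempty exactly when \<open>A\<close> contains an arrow \<open>x\<close> of degree \<open>n\<close>, and then
  \<open>A \<cdot> n = {y. x y \<in> A}\<close>. The action laws and directedness follow by factoring arrows; in the
  latter case one factors a common upper bound through the least upper bound of the degrees.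
  For the topology, a continuous local section \<open>g\<close> of \<open>s\<close> with values of degree \<open>n\<close> gives the local
  inverse of the shift, sending \<open>B\<close> with range \<open>v\<close> to the hereditary closure of \<open>g v B\<close>.
  An arrow of degree \<open>p\<close> below \<open>g v b\<close> already lies below the initial segment of degree \<open>n \<or> p\<close>;
  by properness, for \<open>v\<close> in a compact set, avoiding a compact set of such arrows amounts to \<open>B\<close>
  avoiding a compact set of arrows of degree \<open>n\<inverse> (n \<or> p)\<close>, so the local inverse is continuous.\<close>

section \<open>Standing hypotheses and the factorisation of arrows\<close>

locale proper_P_graph =
  fixes Q :: "('q, 'z) monoid_scheme" (structure) and P :: "'q set"
    and L V :: "'a topology" and r s :: "'a \<Rightarrow> 'a" and c :: "'a \<Rightarrow> 'a \<Rightarrow> 'a" and d :: "'a \<Rightarrow> 'q"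
  assumes qlo: "quasi_lattice_ordered Q P"
    and graph: "topological_P_graph Q P L V r s c d"
    and proper: "rd_proper P L V r d"
begin

abbreviation le (infix "\<preceq>" 50) where "x \<preceq> y \<equiv> path_le L r s c x y"
abbreviation paths where "paths \<equiv> path_space L r s c"
abbreviation Fell where "Fell \<equiv> path_topology L r s c"
abbreviation sh where "sh \<equiv> shift L r s c d"
abbreviation dom where "dom n \<equiv> act_U Fell (shift_domain P L r s c d) n"

sublocale group Q
  using qlo by (simp add: quasi_lattice_ordered_def)

lemma P_carrier: "p \<in> P \<Longrightarrow> p \<in> carrier Q"
  and P_mult: "m \<in> P \<Longrightarrow> n \<in> P \<Longrightarrow> m \<otimes> n \<in> P"
  using qlo unfolding quasi_lattice_ordered_def subsemigroup_def by blast+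

lemma P_one: "\<one> \<in> P"
  using qlo by (auto simp: quasi_lattice_ordered_def)

lemma P_lub:
  assumes "m \<in> P" "n \<in> P" "k \<in> P" "qle Q P m k" "qle Q P n k"
  obtains l where "l \<in> P" "qle Q P m l" "qle Q P n l"
    and "\<And>k. k \<in> P \<Longrightarrow> qle Q P m k \<Longrightarrow> qle Q P n k \<Longrightarrow> qle Q P l k"
proof -
  have lub: "\<forall>m\<in>P. \<forall>n\<in>P. (\<exists>k\<in>P. qle Q P m k \<and> qle Q P n k) \<longrightarrow>
      (\<exists>l\<in>P. qle Q P m l \<and> qle Q P n l \<and>
        (\<forall>k\<in>P. qle Q P m k \<and> qle Q P n k \<longrightarrow> qle Q P l k))"
    using qlo by (simp add: quasi_lattice_ordered_def)
  have bound: "\<exists>k\<in>P. qle Q P m k \<and> qle Q P n k"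
    using assms by blast
  obtain l where "l \<in> P" "qle Q P m l" "qle Q P n l"
      "\<forall>k\<in>P. qle Q P m k \<and> qle Q P n k \<longrightarrow> qle Q P l k"
    using lub[THEN bspec, OF assms(1), THEN bspec, OF assms(2), THEN mp, OF bound] by blast
  then show ?thesis
    using that by simp
qed

lemma vertex_arrow: "v \<in> topspace V \<Longrightarrow> v \<in> topspace L"
  and range_vertex: "x \<in> topspace L \<Longrightarrow> r x \<in> topspace V"
  and source_vertex: "x \<in> topspace L \<Longrightarrow> s x \<in> topspace V"
  and vertex_ends: "v \<in> topspace V \<Longrightarrow> r v = v" "v \<in> topspace V \<Longrightarrow> s v = v"
  and unit_left: "x \<in> topspace L \<Longrightarrow> c (r x) x = x"
  and unit_right: "x \<in> topspace L \<Longrightarrow> c x (s x) = x"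
  and degree_vertex: "v \<in> topspace V \<Longrightarrow> d v = \<one>"
  using graph by (auto simp: topological_P_graph_def)

lemma comp_arrow: "c x y \<in> topspace L"
  and comp_range: "r (c x y) = r x"
  and comp_source: "s (c x y) = s y"
  and comp_degree: "d (c x y) = d x \<otimes> d y"
  if "x \<in> topspace L" "y \<in> topspace L" "s x = r y"
  using graph that by (auto simp: topological_P_graph_def composable_def)

lemma comp_assoc:
  "\<lbrakk>x \<in> topspace L; y \<in> topspace L; z \<in> topspace L; s x = r y; s y = r z\<rbrakk>
    \<Longrightarrow> c (c x y) z = c x (c y z)"
  using graph by (simp add: topological_P_graph_def)

lemma continuous_range: "continuous_map L V r"
  and continuous_source: "continuous_map L V s"
  and source_local_homeomorphism: "local_homeomorphism L V s"
  and continuous_comp: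
    "continuous_map (subtopology (prod_topology L L) (composable L r s)) L (\<lambda>(x, y). c x y)"
  and open_comp: "open_map (subtopology (prod_topology L L) (composable L r s)) L (\<lambda>(x, y). c x y)"
  and continuous_degree: "continuous_map L (discrete_topology P) d"
  using graph by (simp_all add: topological_P_graph_def)

lemma arrows_lc: "locally_compact_space L" and arrows_Hausdorff: "Hausdorff_space L"
  and vertices_lc: "locally_compact_space V" and vertices_Hausdorff: "Hausdorff_space V"
  using graph by (simp_all add: topological_P_graph_def lch_space_def)

lemma degree_in_P: "x \<in> topspace L \<Longrightarrow> d x \<in> P"
  using continuous_map_image_subset_topspace[OF continuous_degree] by auto

lemma open_degree_set:
  assumes "n \<in> P"
  shows "openin L (degree_set L d n)"
  using openin_continuous_map_preimage[OF continuous_degree, of "{n}"] assms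
  by (simp add: degree_set_def)

text \<open>The homeomorphism axiom concerns pairs whose two degrees are prescribed. Cancellation in
  the group \<open>Q\<close> first gives \<open>d y = d y'\<close>; then both pairs lie in the same
  domain, where composition is injective.\<close>

lemma factor_unique:
  assumes x: "x \<in> topspace L" "y \<in> topspace L" "s x = r y"
    and x': "x' \<in> topspace L" "y' \<in> topspace L" "s x' = r y'"
    and eq: "c x y = c x' y'" and deg: "d x = d x'"
  shows "x = x'" "y = y'"
proof -
  have "d x \<otimes> d y = d x \<otimes> d y'"
    using comp_degree[OF x] comp_degree[OF x'] eq deg by simp
  then have dy: "d y = d y'"
    using x x' by (simp add: P_carrier degree_in_P)
  let ?S = "{(u, v)\<in>composable L r s. d u = d x \<and> d v = d y}"
  have "homeomorphic_map (subtopology (prod_topology L L) ?S)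
          (subtopology L (degree_set L d (d x \<otimes> d y))) (\<lambda>(x, y). c x y)"
    using graph x degree_in_P unfolding topological_P_graph_def by blast
  then have inj: "inj_on (\<lambda>(x, y). c x y) (topspace (subtopology (prod_topology L L) ?S))"
    by (simp add: homeomorphic_map_def homeomorphic_eq_everything_map)
  have mem: "(x, y) \<in> topspace (subtopology (prod_topology L L) ?S)"
    "(x', y') \<in> topspace (subtopology (prod_topology L L) ?S)"
    using x x' deg dy by (auto simp: composable_def)
  have "(x, y) = (x', y')"
    using inj_onD[OF inj _ mem] eq by simp
  then show "x = x'" "y = y'" by auto
qed

lemma factor_exists:
  assumes z: "z \<in> topspace L" "d z = m \<otimes> n" and mn: "m \<in> P" "n \<in> P"
  obtains x y where "x \<in> topspace L" "y \<in> topspace L" "s x = r y" "d x = m" "d y = n" "z = c x y"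
proof -
  let ?S = "{(x, y)\<in>composable L r s. d x = m \<and> d y = n}"
  have "homeomorphic_map (subtopology (prod_topology L L) ?S)
          (subtopology L (degree_set L d (m \<otimes> n))) (\<lambda>(x, y). c x y)"
    using graph mn unfolding topological_P_graph_def by blast
  then have "(\<lambda>(x, y). c x y) ` topspace (subtopology (prod_topology L L) ?S)
      = topspace (subtopology L (degree_set L d (m \<otimes> n)))"
    by (rule homeomorphic_imp_surjective_map)
  moreover have "z \<in> topspace (subtopology L (degree_set L d (m \<otimes> n)))"
    using z by (simp add: degree_set_def)
  ultimately have "z \<in> (\<lambda>(x, y). c x y) ` topspace (subtopology (prod_topology L L) ?S)"
    by simp
  then show ?thesis
    using that by (auto simp: composable_def)
qed

text \<open>An arrow of degree one factors both as \<open>r x\<close> followed by \<open>x\<close>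
  and as \<open>x\<close> followed by \<open>s x\<close>, with first factors of equal degree, so
  unique factorisation identifies \<open>x\<close> with \<open>r x\<close>.\<close>

lemma degree_one_iff:
  assumes "x \<in> topspace L"
  shows "d x = \<one> \<longleftrightarrow> x \<in> topspace V"
proof
  assume "d x = \<one>"
  then have "r x = x"
    using assms
    by (intro factor_unique(1)[of "r x" x x "s x"])
      (auto simp: range_vertex source_vertex vertex_arrow vertex_ends unit_left unit_right
        degree_vertex)
  then show "x \<in> topspace V"
    using range_vertex[OF assms] by simp
qed (rule degree_vertex)

text \<open>Vertices are exactly the arrows of degree one, so \<open>W\<close> is the intersection
  of two open sets: the preimage of \<open>W\<close> under \<open>r\<close> and the arrows of degree
  one. Conditions on the vertex of a path thereby become Fell-open.\<close>

lemma open_vertices: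
  assumes "openin V W"
  shows "openin L W"
proof -
  have "W = {x \<in> topspace L. r x \<in> W} \<inter> degree_set L d \<one>"
    using openin_subset[OF assms]
    by (auto simp: degree_set_def vertex_ends degree_one_iff vertex_arrow)
  moreover have "openin L ({x \<in> topspace L. r x \<in> W} \<inter> degree_set L d \<one>)"
    by (intro openin_Int openin_continuous_map_preimage[OF continuous_range] assms
        open_degree_set P_one)
  ultimately show ?thesis by simp
qed

subsection \<open>The order on arrows\<close>

lemma le_arrows: "x \<preceq> y \<Longrightarrow> x \<in> topspace L" "x \<preceq> y \<Longrightarrow> y \<in> topspace L"
  by (auto simp: path_le_def comp_arrow)

lemma le_range: "x \<preceq> y \<Longrightarrow> r x = r y"
  by (auto simp: path_le_def comp_range)

lemma le_degree: "x \<preceq> y \<Longrightarrow> qle Q P (d x) (d y)"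
  by (auto simp: path_le_def qle_def comp_degree degree_in_P)

lemma le_comp: "\<lbrakk>x \<in> topspace L; y \<in> topspace L; s x = r y\<rbrakk> \<Longrightarrow> x \<preceq> c x y"
  by (auto simp: path_le_def)

lemma le_refl: "x \<in> topspace L \<Longrightarrow> x \<preceq> x"
  using le_comp[of x "s x"] by (simp add: unit_right source_vertex vertex_arrow vertex_ends)

lemma range_le: "x \<in> topspace L \<Longrightarrow> r x \<preceq> x"
  using le_comp[of "r x" x] by (simp add: unit_left range_vertex vertex_arrow vertex_ends)

lemma le_trans:
  assumes "x \<preceq> y" "y \<preceq> z"
  shows "x \<preceq> z"
proof -
  obtain u where u: "x \<in> topspace L" "u \<in> topspace L" "s x = r u" "y = c x u"
    using assms(1) by (auto simp: path_le_def)
  obtain v where v: "v \<in> topspace L" "s y = r v" "z = c y v"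
    using assms(2) by (auto simp: path_le_def)
  have "s u = r v" using u v by (simp add: comp_source)
  then show ?thesis
    using u v le_comp[of x "c u v"] by (simp add: comp_assoc comp_arrow comp_range)
qed

lemma le_unique:
  assumes "x \<preceq> z" "y \<preceq> z" "d x = d y"
  shows "x = y"
  using assms factor_unique(1) unfolding path_le_def by metis

lemma comp_mono:
  assumes "x \<in> topspace L" "y \<preceq> z" "s x = r y"
  shows "c x y \<preceq> c x z"
proof -
  obtain u where u: "y \<in> topspace L" "u \<in> topspace L" "s y = r u" "z = c y u"
    using assms(2) by (auto simp: path_le_def)
  then show ?thesis
    using assms le_comp[of "c x y" u] by (simp add: comp_assoc comp_arrow comp_source)
qed

text \<open>Associativity gives two factorisations of \<open>c x z\<close> with the same first
  factor \<open>x\<close>, so their second factors agree.\<close>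

lemma comp_le_cancel:
  assumes x: "x \<in> topspace L" "y \<in> topspace L" "s x = r y" "z \<in> topspace L" "s x = r z"
    and le: "c x y \<preceq> c x z"
  shows "y \<preceq> z"
proof -
  obtain u where u: "u \<in> topspace L" "s (c x y) = r u" "c x z = c (c x y) u"
    using le by (auto simp: path_le_def)
  then have su: "s y = r u" using x by (simp add: comp_source)
  have "z = c y u"
    using x u su
    by (intro factor_unique(2)[of x z x "c y u"]) (auto simp: comp_arrow comp_range comp_assoc)
  then show ?thesis
    using le_comp x u su by simp
qed

text \<open>Factor \<open>z\<close> at degree \<open>l\<close> to get \<open>w\<close>, then factor
  \<open>w\<close> at degree \<open>d y\<close>. The initial piece lies below \<open>z\<close> and
  has the degree of \<open>y\<close>, hence equals \<open>y\<close>.\<close>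

lemma segment:
  assumes "y \<preceq> z" "l \<in> P" "qle Q P (d y) l" "qle Q P l (d z)"
  obtains w where "y \<preceq> w" "w \<preceq> z" "d w = l"
proof -
  obtain q where q: "q \<in> P" "d z = l \<otimes> q" using assms(4) by (auto simp: qle_def)
  obtain w t where w: "w \<in> topspace L" "t \<in> topspace L" "s w = r t" "d w = l" "z = c w t"
    using factor_exists[of z l q] q assms le_arrows by metis
  obtain p where p: "p \<in> P" "l = d y \<otimes> p" using assms(3) by (auto simp: qle_def)
  obtain y' u where y': "y' \<in> topspace L" "u \<in> topspace L" "s y' = r u" "d y' = d y" "w = c y' u"
    using factor_exists[of w "d y" p] p assms w le_arrows degree_in_P by metis
  have "y' \<preceq> w" "w \<preceq> z" using w y' le_comp by auto
  moreover from this have "y' = y" using le_unique le_trans assms(1) y'(4) by blast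
  ultimately show ?thesis using that w by blast
qed

subsection \<open>Paths\<close>

lemma path_arrows: "A \<in> paths \<Longrightarrow> x \<in> A \<Longrightarrow> x \<in> topspace L"
  using closedin_subset by (fastforce simp: path_space_def)

lemma path_hereditary: "A \<in> paths \<Longrightarrow> y \<in> A \<Longrightarrow> x \<preceq> y \<Longrightarrow> x \<in> A"
  by (auto simp: path_space_def hereditary_def)

lemma path_directed:
  assumes "A \<in> paths" "x \<in> A" "y \<in> A"
  obtains z where "z \<in> A" "x \<preceq> z" "y \<preceq> z"
  using assms by (auto simp: path_space_def directed_set_def)

lemma path_degree_unique: "A \<in> paths \<Longrightarrow> x \<in> A \<Longrightarrow> y \<in> A \<Longrightarrow> d x = d y \<Longrightarrow> x = y"
  by (meson path_directed le_unique)

lemma path_range_unique: "A \<in> paths \<Longrightarrow> x \<in> A \<Longrightarrow> y \<in> A \<Longrightarrow> r x = r y"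
  by (metis path_directed le_range)

lemma path_range: "A \<in> paths \<Longrightarrow> x \<in> A \<Longrightarrow> r x \<in> A"
  using path_hereditary range_le path_arrows by blast

lemma path_vertex:
  assumes "A \<in> paths" "x \<in> A" "v \<in> A" "v \<in> topspace V"
  shows "r x = v"
  using path_range_unique[OF assms(1-3)] vertex_ends assms by simp

text \<open>Closedness is automatic: a directed set has at most one element in each of the clopen
  sets of arrows of a fixed degree.\<close>

lemma pathI:
  assumes ne: "A \<noteq> {}" and sub: "A \<subseteq> topspace L"
    and her: "hereditary L r s c A" and dir: "directed_set L r s c A"
  shows "A \<in> paths"
proof -
  have "openin L (topspace L - A)"
  proof (subst openin_subopen, intro ballI)
    fix y assume y: "y \<in> topspace L - A"
    let ?D = "degree_set L d (d y)"
    have "z = z'" if z: "z \<in> A \<inter> ?D" "z' \<in> A \<inter> ?D" for z z'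
    proof -
      obtain w where "z \<preceq> w" "z' \<preceq> w"
        using z dir by (auto simp: directed_set_def)
      then show ?thesis
        using z by (intro le_unique) (auto simp: degree_set_def)
    qed
    then have "A \<inter> ?D \<subseteq> {THE z. z \<in> A \<inter> ?D}"
      by (metis (no_types, lifting) singleton_iff subsetI the_equality)
    then have "finite (A \<inter> ?D)"
      using finite_subset by blast
    then have "closedin L (A \<inter> ?D)"
      using arrows_Hausdorff sub by (intro closedin_Hausdorff_finite) auto
    then have "openin L (?D - A \<inter> ?D)"
      using open_degree_set degree_in_P y by (intro openin_diff) auto
    then show "\<exists>T. openin L T \<and> y \<in> T \<and> T \<subseteq> topspace L - A"
      using y by (intro exI[of _ "?D - A \<inter> ?D"]) (auto simp: degree_set_def)
  qed
  then show ?thesis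
    using assms by (simp add: path_space_def closedin_def)
qed

lemma shift_eq:
  assumes "A \<in> paths" "x \<in> A"
  shows "sh A (d x) = {y \<in> topspace L. s x = r y \<and> c x y \<in> A}"
proof -
  have "x' = x" if "x' \<in> topspace L" "d x' = d x" "y \<in> topspace L" "s x' = r y" "c x' y \<in> A" for x' y
    using that assms path_degree_unique path_hereditary le_comp by metis
  then show ?thesis
    using path_arrows[OF assms] by (auto simp: shift_def)
qed

lemma shift_nonempty_iff:
  assumes "A \<in> paths"
  shows "sh A n \<noteq> {} \<longleftrightarrow> (\<exists>x\<in>A. d x = n)"
proof
  assume "sh A n \<noteq> {}"
  then show "\<exists>x\<in>A. d x = n"
    using path_hereditary[OF assms] le_comp by (fastforce simp: shift_def)
next
  assume "\<exists>x\<in>A. d x = n"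
  then obtain x where x: "x \<in> A" "d x = n" by blast
  \<comment> \<open>The source vertex is a witness because composing \<open>x\<close> with it gives
    back \<open>x\<close>.\<close>
  then have "s x \<in> sh A n"
    using assms path_arrows[OF assms]
    by (auto simp: shift_def source_vertex vertex_arrow vertex_ends unit_right intro!: bexI[of _ x])
  then show "sh A n \<noteq> {}" by blast
qed

text \<open>For directedness, a common upper bound in \<open>A\<close> of \<open>c x y\<close> and
  \<open>c x y'\<close> lies above \<open>x\<close>, so it has the form \<open>c x u\<close>;
  cancelling \<open>x\<close> on the left makes \<open>u\<close> an upper bound of \<open>y\<close>
  and \<open>y'\<close>.\<close>

lemma shift_path:
  assumes A: "A \<in> paths" "x \<in> A"
  shows "sh A (d x) \<in> paths"
proof (rule pathI)
  show "sh A (d x) \<noteq> {}"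
    using shift_nonempty_iff A by blast
  show "sh A (d x) \<subseteq> topspace L"
    by (auto simp: shift_def)
  note x = path_arrows[OF A]
  show "hereditary L r s c (sh A (d x))"
    unfolding hereditary_def shift_eq[OF A]
    using comp_mono[OF x] path_hereditary[OF A(1)] le_arrows le_range by auto
  show "directed_set L r s c (sh A (d x))"
    unfolding directed_set_def
  proof (intro ballI)
    fix y y' assume "y \<in> sh A (d x)" "y' \<in> sh A (d x)"
    then have y: "y \<in> topspace L" "s x = r y" "c x y \<in> A"
      and y': "y' \<in> topspace L" "s x = r y'" "c x y' \<in> A"
      by (auto simp: shift_eq[OF A])
    obtain z where z: "z \<in> A" "c x y \<preceq> z" "c x y' \<preceq> z"
      using path_directed[OF A(1)] y y' by metis
    have "x \<preceq> z" using z le_trans le_comp x y by blast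
    then obtain u where u: "u \<in> topspace L" "s x = r u" "z = c x u"
      by (auto simp: path_le_def)
    then show "\<exists>z\<in>sh A (d x). y \<preceq> z \<and> y' \<preceq> z"
      using z x y y' comp_le_cancel by (intro bexI[of _ u]) (auto simp: shift_eq[OF A])
  qed
qed

text \<open>If all elements of \<open>B\<close> have range \<open>v\<close>, this is the hereditary closure of \<open>g v B\<close>; letting
  \<open>g\<close> act through \<open>r b\<close> avoids choosing \<open>v\<close>.\<close>

definition glue :: "('a \<Rightarrow> 'a) \<Rightarrow> 'a set \<Rightarrow> 'a set" where
  "glue g B = {y. \<exists>b\<in>B. y \<preceq> c (g (r b)) b}"

lemma glue_eq:
  assumes "B \<in> paths" "v \<in> B" "v \<in> topspace V"
  shows "glue g B = {y. \<exists>b\<in>B. y \<preceq> c (g v) b}"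
  using path_vertex[OF assms(1) _ assms(2,3)] by (auto simp: glue_def)

text \<open>Composition with \<open>g v\<close> on the left preserves the order, so upper bounds are
  inherited from \<open>B\<close>; it also reflects the order, so shifting recovers exactly
  \<open>B\<close>. This makes \<open>glue g\<close> a right inverse of the shift.\<close>

lemma glue_path:
  assumes B: "B \<in> paths" "v \<in> B" "v \<in> topspace V" and g: "g v \<in> topspace L" "s (g v) = v"
  shows "glue g B \<in> paths" "g v \<in> glue g B" "sh (glue g B) (d (g v)) = B"
proof -
  note eq = glue_eq[OF B]
  have rB: "b \<in> topspace L" "s (g v) = r b" if "b \<in> B" for b
    using path_vertex[OF B(1) that B(2,3)] g path_arrows[OF B(1) that] by auto
  have "c (g v) v = g v" using unit_right[OF g(1)] g by simp
  then have "g v \<preceq> c (g v) v" using le_refl[OF g(1)] by simp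
  then show gv: "g v \<in> glue g B"
    unfolding eq using B by blast
  show path: "glue g B \<in> paths"
  proof (rule pathI)
    show "glue g B \<noteq> {}" using gv by blast
    show "glue g B \<subseteq> topspace L" unfolding eq using le_arrows by blast
    show "hereditary L r s c (glue g B)"
      unfolding eq hereditary_def using le_trans by blast
    show "directed_set L r s c (glue g B)"
      unfolding directed_set_def
    proof (intro ballI)
      fix y y' assume "y \<in> glue g B" "y' \<in> glue g B"
      then obtain b b' where b: "b \<in> B" "y \<preceq> c (g v) b" "b' \<in> B" "y' \<preceq> c (g v) b'"
        by (auto simp: eq)
      obtain b'' where b'': "b'' \<in> B" "b \<preceq> b''" "b' \<preceq> b''"
        using path_directed[OF B(1)] b by metis
      then have "y \<preceq> c (g v) b''" "y' \<preceq> c (g v) b''"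
        using b comp_mono[OF g(1)] rB le_trans by blast+
      moreover have "c (g v) b'' \<in> glue g B"
        using b'' rB le_refl comp_arrow g unfolding eq by blast
      ultimately show "\<exists>z\<in>glue g B. y \<preceq> z \<and> y' \<preceq> z"
        by blast
    qed
  qed
  show "sh (glue g B) (d (g v)) = B"
    unfolding shift_eq[OF path gv]
  proof (intro equalityI subsetI)
    fix y assume "y \<in> {y \<in> topspace L. s (g v) = r y \<and> c (g v) y \<in> glue g B}"
    then obtain b where "y \<in> topspace L" "s (g v) = r y" "b \<in> B" "c (g v) y \<preceq> c (g v) b"
      by (auto simp: eq)
    then show "y \<in> B"
      using comp_le_cancel[OF g(1)] rB path_hereditary[OF B(1)] by blast
  next
    fix b assume b: "b \<in> B"
    then have "c (g v) b \<in> glue g B"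
      unfolding eq using rB le_refl comp_arrow g by blast
    then show "b \<in> {y \<in> topspace L. s (g v) = r y \<and> c (g v) y \<in> glue g B}"
      using rB b by blast
  qed
qed

text \<open>The other half of the inverse relation. The hypothesis \<open>g (s x) = x\<close> says
  that the section passes through the arrow \<open>x\<close> of \<open>A\<close>; by directedness
  every element of \<open>A\<close> lies below some \<open>c x u\<close> in
  \<open>A\<close>.\<close>

lemma glue_shift:
  assumes A: "A \<in> paths" "x \<in> A" and g: "g (s x) = x"
  shows "glue g (sh A (d x)) = A"
proof -
  have eq: "glue g (sh A (d x)) = {y. \<exists>b\<in>sh A (d x). y \<preceq> c x b}"
    unfolding glue_def using g by (auto simp: shift_eq[OF A])
  show ?thesis
  proof (intro equalityI subsetI)
    fix y assume "y \<in> glue g (sh A (d x))"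
    then obtain b where "b \<in> sh A (d x)" "y \<preceq> c x b"
      unfolding eq by blast
    then show "y \<in> A"
      using path_hereditary[OF A(1)] by (auto simp: shift_eq[OF A])
  next
    fix y assume y: "y \<in> A"
    then obtain z where z: "z \<in> A" "y \<preceq> z" "x \<preceq> z"
      using path_directed[OF A(1) _ A(2)] by metis
    then obtain u where u: "u \<in> topspace L" "s x = r u" "z = c x u"
      by (auto simp: path_le_def)
    then have "u \<in> sh A (d x)" using z by (simp add: shift_eq[OF A])
    then show "y \<in> glue g (sh A (d x))"
      unfolding eq using z u by blast
  qed
qed

subsection \<open>The partial action\<close>

text \<open>Missing the empty compact set is no condition, so the whole path space is itself a
  subbasic set.\<close>

lemma topspace_Fell: "topspace Fell = paths"
proof -
  have "{F \<in> paths. F \<inter> {} = {}} = paths" by auto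
  moreover have "compactin L {}" by simp
  ultimately have "paths \<in> {{F \<in> paths. F \<inter> K = {}} | K. compactin L K}" by blast
  then show ?thesis
    unfolding path_topology_def topology_generated_by_topspace by blast
qed

lemma dom_eq: "n \<in> P \<Longrightarrow> dom n = {A \<in> paths. \<exists>x\<in>A. d x = n}"
  by (simp add: act_U_def shift_domain_def topspace_Fell shift_nonempty_iff cong: conj_cong)

text \<open>The degree-one arrow used here is the vertex \<open>r x\<close>. It is the range of
  every element of \<open>A\<close>, and left composition with it is the identity on
  \<open>A\<close>.\<close>

lemma shift_one:
  assumes "A \<in> paths"
  shows "sh A \<one> = A"
proof -
  obtain x where x: "x \<in> A" using assms by (auto simp: path_space_def)
  have v: "r x \<in> A" "r x \<in> topspace V"
    using path_range[OF assms x] range_vertex path_arrows[OF assms x] by auto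
  have "sh A (d (r x)) = A"
    unfolding shift_eq[OF assms v(1)]
    using path_vertex[OF assms _ v] path_arrows[OF assms] v
    by (auto simp: vertex_ends) (metis unit_left)+
  then show ?thesis using degree_vertex v by simp
qed

text \<open>One inclusion composes the two removed arrows; the other factors an arrow of degree
  \<open>m \<otimes> n\<close>. \<open>A\<close> is an arbitrary set, so the law also covers empty
  shifts.\<close>

lemma shift_shift:
  assumes "m \<in> P" "n \<in> P"
  shows "sh (sh A m) n = sh A (m \<otimes> n)"
proof (intro equalityI subsetI)
  fix y assume "y \<in> sh (sh A m) n"
  then obtain x x' where h: "y \<in> topspace L" "x' \<in> topspace L" "d x' = n" "s x' = r y"
      "x \<in> topspace L" "d x = m" "s x = r (c x' y)" "c x (c x' y) \<in> A"
    by (auto simp: shift_def)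
  then show "y \<in> sh A (m \<otimes> n)"
    by (auto simp: shift_def comp_range comp_source comp_arrow comp_degree comp_assoc
        intro!: bexI[of _ "c x x'"])
next
  fix y assume "y \<in> sh A (m \<otimes> n)"
  then obtain w where w: "y \<in> topspace L" "w \<in> topspace L" "d w = m \<otimes> n" "s w = r y" "c w y \<in> A"
    by (auto simp: shift_def)
  obtain x x' where x: "x \<in> topspace L" "x' \<in> topspace L" "s x = r x'" "d x = m" "d x' = n" "w = c x x'"
    using factor_exists[OF w(2,3) assms] by metis
  then have "s x' = r y" "c x (c x' y) \<in> A"
    using w by (auto simp: comp_source comp_assoc)
  then have "c x' y \<in> sh A m"
    using x w by (auto simp: shift_def comp_arrow comp_range)
  then show "y \<in> sh (sh A m) n"
    using x w \<open>s x' = r y\<close> unfolding shift_def[of _ _ _ _ _ "sh A m"] by blast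
qed

lemma shift_in_paths: "A \<in> paths \<Longrightarrow> y \<in> sh A n \<Longrightarrow> sh A n \<in> paths"
  using shift_nonempty_iff[of A n] shift_path[of A] by auto

lemma partial_action_shift: "partial_action Q P Fell (shift_domain P L r s c d) sh"
proof -
  have ne: "A \<noteq> {}" if "A \<in> paths" for A using that by (simp add: path_space_def)
  have empty: "sh {} n = {}" for n by (simp add: shift_def)
  show ?thesis
    unfolding partial_action_def topspace_Fell
  proof (intro conjI ballI)
    fix A m n assume A: "A \<in> paths" and mn: "m \<in> P" "n \<in> P"
    \<comment> \<open>If the shift by \<open>m\<close> were empty, so would be its further shift by
      \<open>n\<close>.\<close>
    have "sh A m \<noteq> {}" if "sh A (m \<otimes> n) \<noteq> {}"
      using that empty shift_shift[OF mn, of A] by auto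
    then show "(A, m \<otimes> n) \<in> shift_domain P L r s c d \<longleftrightarrow>
        (A, m) \<in> shift_domain P L r s c d \<and> (sh A m, n) \<in> shift_domain P L r s c d"
      using A mn by (auto simp: shift_domain_def P_mult shift_shift intro: shift_in_paths)
    show "(A, m \<otimes> n) \<in> shift_domain P L r s c d \<longrightarrow> sh (sh A m) n = sh A (m \<otimes> n)"
      using mn by (simp add: shift_shift)
  qed (auto simp: shift_domain_def P_one shift_one ne intro: shift_in_paths)
qed

text \<open>The witness is the least upper bound \<open>l\<close> of \<open>m\<close> and
  \<open>n\<close>. A path with arrows of degrees \<open>m\<close> and \<open>n\<close> has a common
  upper bound of them, whose degree is above \<open>l\<close>; an initial segment of it then has
  degree \<open>l\<close>.\<close>

lemma directed_action_shift: "directed_action Q P Fell (shift_domain P L r s c d)"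
  unfolding directed_action_def
proof (intro ballI impI)
  fix m n assume mn: "m \<in> P" "n \<in> P" and "dom m \<inter> dom n \<noteq> {}"
  have bound: "\<exists>z\<in>A. qle Q P m (d z) \<and> qle Q P n (d z)" if A: "A \<in> dom m \<inter> dom n" for A
  proof -
    obtain x y where x: "A \<in> paths" "x \<in> A" "d x = m" "y \<in> A" "d y = n"
      using A unfolding dom_eq[OF mn(1)] dom_eq[OF mn(2)] by blast
    obtain z where "z \<in> A" "x \<preceq> z" "y \<preceq> z"
      using path_directed x by metis
    then show ?thesis using le_degree x by blast
  qed
  then obtain A z where z: "A \<in> paths" "z \<in> A" "qle Q P m (d z)" "qle Q P n (d z)"
    using \<open>dom m \<inter> dom n \<noteq> {}\<close> unfolding dom_eq[OF mn(1)] by blast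
  obtain l where l: "l \<in> P" "qle Q P m l" "qle Q P n l"
    and least: "\<And>k. k \<in> P \<Longrightarrow> qle Q P m k \<Longrightarrow> qle Q P n k \<Longrightarrow> qle Q P l k"
    using P_lub[OF mn degree_in_P z(3,4)] path_arrows z by metis
  \<comment> \<open>Degrees in a path are closed downwards: apply \<open>segment\<close> between the
    vertex \<open>r w\<close>, of degree one, and \<open>w\<close>.\<close>
  have down: "\<exists>x\<in>B. d x = k" if k: "B \<in> paths" "w \<in> B" "k \<in> P" "qle Q P k (d w)" for B w k
  proof -
    note w = path_arrows[OF k(1,2)]
    have "qle Q P (d (r w)) k"
      using w k by (simp add: qle_def degree_vertex range_vertex P_carrier)
    then obtain x where "x \<preceq> w" "d x = k"
      using segment[OF range_le[OF w] k(3) _ k(4)] by metis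
    then show ?thesis using k path_hereditary by blast
  qed
  have "B \<in> dom m \<inter> dom n \<longleftrightarrow> B \<in> dom l" for B
  proof
    assume B: "B \<in> dom m \<inter> dom n"
    then have B': "B \<in> paths" by (simp add: dom_eq mn)
    obtain w where "w \<in> B" "qle Q P m (d w)" "qle Q P n (d w)" using bound[OF B] by blast
    then show "B \<in> dom l"
      using down[OF B' _ l(1)] least degree_in_P path_arrows[OF B'] B' by (auto simp: dom_eq l)
  next
    assume "B \<in> dom l"
    then show "B \<in> dom m \<inter> dom n"
      using down l mn by (fastforce simp: dom_eq)
  qed
  then show "\<exists>k\<in>P. qle Q P m k \<and> qle Q P n k \<and> dom m \<inter> dom n = dom k"
    using l by blast
qed

subsection \<open>The Fell topology\<close>

lemma open_hit: "openin L U \<Longrightarrow> openin Fell {F \<in> paths. F \<inter> U \<noteq> {}}"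
  unfolding path_topology_def by (rule topology_generated_by_Basis) blast

lemma open_miss: "compactin L K \<Longrightarrow> openin Fell {F \<in> paths. F \<inter> K = {}}"
  unfolding path_topology_def by (rule topology_generated_by_Basis) blast

lemma openin_Fell_subset: "openin Fell W \<Longrightarrow> W \<subseteq> paths"
  using openin_subset topspace_Fell by fastforce

text \<open>It is enough to test compact sets on which the degree is constant, since a compact set meets
  only finitely many of the clopen sets of arrows of a fixed degree.\<close>

lemma continuous_into_Fell:
  assumes W: "openin Fell W" and f: "\<And>A. A \<in> W \<Longrightarrow> f A \<in> paths"
    and hit: "\<And>U. openin L U \<Longrightarrow> openin Fell {A \<in> W. f A \<inter> U \<noteq> {}}"
    and miss: "\<And>p K. p \<in> P \<Longrightarrow> compactin L K \<Longrightarrow> K \<subseteq> degree_set L d p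
      \<Longrightarrow> openin Fell {A \<in> W. f A \<inter> K = {}}"
  shows "continuous_map (subtopology Fell W) Fell f"
proof -
  have top: "topspace (subtopology Fell W) = W"
    using openin_Fell_subset[OF W] topspace_Fell by auto
  have missK: "openin Fell {A \<in> W. f A \<inter> K = {}}" if K: "compactin L K" for K
  proof -
    have KL: "K \<subseteq> topspace L" using K compactin_subset_topspace by blast
    have "compactin (discrete_topology P) (d ` K)"
      using image_compactin[OF K continuous_degree] .
    then have fin: "finite (d ` K)" by (simp add: compactin_discrete_topology)
    have open1: "openin Fell {A \<in> W. f A \<inter> (K \<inter> degree_set L d p) = {}}" if "p \<in> d ` K" for p
    proof (rule miss)
      show p: "p \<in> P" using that KL degree_in_P by auto
      \<comment> \<open>Being the preimage of a closed singleton, the degree set is closed as well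
        as open, so it cuts \<open>K\<close> to a compact piece.\<close>
      have "degree_set L d p = {x \<in> topspace L. d x \<in> {p}}" by (auto simp: degree_set_def)
      moreover have "closedin L {x \<in> topspace L. d x \<in> {p}}"
        by (intro closedin_continuous_map_preimage[OF continuous_degree]) (simp add: p)
      ultimately show "compactin L (K \<inter> degree_set L d p)"
        using compact_Int_closedin[OF K] by simp
    qed auto
    have eq: "{A \<in> W. f A \<inter> K = {}} =
        W \<inter> \<Inter> ((\<lambda>p. {A \<in> W. f A \<inter> (K \<inter> degree_set L d p) = {}}) ` d ` K)"
      using KL by (auto simp: degree_set_def)
    \<comment> \<open>For empty \<open>K\<close> the family of degrees is empty and its intersection
      is the whole type, hence the separate case.\<close>
    show ?thesis
    proof (cases "K = {}")
      case False
      then show ?thesis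
        unfolding eq using fin open1 W by (intro openin_Int openin_Inter) auto
    qed (use W in simp)
  qed
  show ?thesis
    unfolding path_topology_def[of L r s c] continuous_on_generated_topo_iff
    unfolding path_topology_def[of L r s c, symmetric] top
  proof (intro conjI allI impI)
    fix U
    assume "U \<in> {{F \<in> paths. F \<inter> K = {}} |K. compactin L K} \<union>
      {{F \<in> paths. F \<inter> U \<noteq> {}} |U. openin L U}"
    then have "(\<exists>K. compactin L K \<and> f -` U \<inter> W = {A \<in> W. f A \<inter> K = {}}) \<or>
        (\<exists>G. openin L G \<and> f -` U \<inter> W = {A \<in> W. f A \<inter> G \<noteq> {}})"
      using f by blast
    then have "openin Fell (f -` U \<inter> W)" using missK hit by auto
    then show "openin (subtopology Fell W) (f -` U \<inter> W)"
      by (simp add: W openin_open_subtopology)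
  next
    have "f ` W \<subseteq> topspace Fell" using f topspace_Fell by auto
    then show "f ` W \<subseteq> \<Union> ({{F \<in> paths. F \<inter> K = {}} |K. compactin L K} \<union>
      {{F \<in> paths. F \<inter> U \<noteq> {}} |U. openin L U})"
      unfolding path_topology_def by simp
  qed
qed

section \<open>Products of sets of arrows and compactness from properness\<close>

definition comps :: "'a set \<Rightarrow> 'a set \<Rightarrow> 'a set" where
  "comps A B = {c x y | x y. x \<in> A \<and> y \<in> B \<and> s x = r y}"

lemma comps_image:
  assumes "A \<subseteq> topspace L" "B \<subseteq> topspace L"
  shows "comps A B = (\<lambda>(x, y). c x y) ` (A \<times> B \<inter> composable L r s)"
  using assms by (fastforce simp: comps_def composable_def)

text \<open>Openness of the composition map enters here. Conditions on the factors of an arrow in a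
  path can thus be stated as meeting an open set.\<close>

lemma open_comps:
  assumes "openin L A" "openin L B"
  shows "openin L (comps A B)"
proof -
  have "openin (subtopology (prod_topology L L) (composable L r s)) (A \<times> B \<inter> composable L r s)"
    using assms by (intro openin_subtopology_Int) (simp add: openin_prod_Times_iff)
  then show ?thesis
    using open_comp openin_subset[OF assms(1)] openin_subset[OF assms(2)]
    by (simp add: comps_image open_map_def)
qed

text \<open>This is the equaliser of two continuous maps into the Hausdorff space of
  vertices.\<close>

lemma closed_composable: "closedin (prod_topology L L) (composable L r s)"
proof -
  have "closedin (prod_topology L L) {z \<in> topspace (prod_topology L L). (s \<circ> fst) z = (r \<circ> snd) z}"
    by (intro closedin_continuous_maps_eq[OF vertices_Hausdorff] continuous_map_compose[of _ L]
        continuous_map_fst continuous_map_snd continuous_source continuous_range)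
  moreover have "{z \<in> topspace (prod_topology L L). (s \<circ> fst) z = (r \<circ> snd) z} = composable L r s"
    by (auto simp: composable_def)
  ultimately show ?thesis by simp
qed

lemma compact_comps:
  assumes A: "compactin L A" and B: "compactin L B"
  shows "compactin L (comps A B)"
proof -
  have "compactin (prod_topology L L) (A \<times> B \<inter> composable L r s)"
    by (intro compact_Int_closedin closed_composable) (simp add: compactin_Times A B)
  then have "compactin (subtopology (prod_topology L L) (composable L r s))
      (A \<times> B \<inter> composable L r s)"
    by (simp add: compactin_subtopology)
  from image_compactin[OF this continuous_comp] show ?thesis
    using compactin_subset_topspace[OF A] compactin_subset_topspace[OF B] by (simp add: comps_image)
qed

text \<open>Properness of the map formed by \<open>r\<close> and \<open>d\<close> enters here: the
  set is the preimage of the compact set \<open>C \<times> {p}\<close>.\<close>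

lemma compact_range_degree:
  assumes "compactin V C" "p \<in> P"
  shows "compactin L {y \<in> topspace L. r y \<in> C \<and> d y = p}"
proof -
  have "compactin (prod_topology V (discrete_topology P)) (C \<times> {p})"
    using assms by (simp add: compactin_Times compactin_discrete_topology)
  then have "compactin L {y \<in> topspace L. (r y, d y) \<in> C \<times> {p}}"
    using proper unfolding rd_proper_def by (rule compactin_proper_map_preimage[rotated])
  then show ?thesis by simp
qed

lemma compact_nbhd:
  assumes "locally_compact_space Y" "Hausdorff_space Y" "openin Y W" "x \<in> W"
  obtains G C where "openin Y G" "compactin Y C" "x \<in> G" "G \<subseteq> C" "C \<subseteq> W"
proof -
  have "neighbourhood_base_of (\<lambda>C. compactin Y C \<and> closedin Y C) Y"
    using assms locally_compact_Hausdorff_imp_regular_space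
    by (simp flip: locally_compact_regular_space_neighbourhood_base)
  then show ?thesis
    using assms(3,4) that unfolding neighbourhood_base_of by meson
qed

section \<open>Open domains and continuity of the shift\<close>

lemma shift_in_paths_dom: "n \<in> P \<Longrightarrow> A \<in> dom n \<Longrightarrow> sh A n \<in> paths"
  using shift_path by (auto simp: dom_eq)

lemma dom_hit: "n \<in> P \<Longrightarrow> dom n = {A \<in> paths. A \<inter> degree_set L d n \<noteq> {}}"
  using path_arrows by (auto simp: dom_eq degree_set_def)

lemma open_dom: "n \<in> P \<Longrightarrow> openin Fell (dom n)"
  by (simp add: dom_hit open_hit open_degree_set)

text \<open>The shift of \<open>A\<close> meets \<open>U\<close> iff \<open>A\<close> meets the open
  product of the arrows of degree \<open>n\<close> with \<open>U\<close>. For a compact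
  \<open>K\<close>, the arrow of degree \<open>n\<close> is first confined to a compact
  neighbourhood \<open>C\<close>; then it suffices that \<open>A\<close> misses the compact product
  of \<open>C\<close> and \<open>K\<close>.\<close>

lemma continuous_shift:
  assumes n: "n \<in> P"
  shows "continuous_map (subtopology Fell (dom n)) Fell (\<lambda>A. sh A n)"
proof (rule continuous_into_Fell)
  fix U assume U: "openin L U"
  have "{A \<in> dom n. sh A n \<inter> U \<noteq> {}} = {A \<in> paths. A \<inter> comps (degree_set L d n) U \<noteq> {}}"
  proof (intro equalityI subsetI)
    fix A assume "A \<in> {A \<in> dom n. sh A n \<inter> U \<noteq> {}}"
    then obtain x y where "A \<in> paths" "y \<in> U" "x \<in> topspace L" "d x = n" "s x = r y" "c x y \<in> A"
      using dom_eq[OF n] by (auto simp: shift_def)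
    then show "A \<in> {A \<in> paths. A \<inter> comps (degree_set L d n) U \<noteq> {}}"
      unfolding comps_def degree_set_def by blast
  next
    fix A assume "A \<in> {A \<in> paths. A \<inter> comps (degree_set L d n) U \<noteq> {}}"
    then obtain x y where h: "A \<in> paths" "y \<in> U" "x \<in> topspace L" "d x = n" "s x = r y" "c x y \<in> A"
      by (auto simp: comps_def degree_set_def)
    then have "y \<in> sh A n" using openin_subset[OF U] by (auto simp: shift_def)
    then show "A \<in> {A \<in> dom n. sh A n \<inter> U \<noteq> {}}"
      using h shift_nonempty_iff[of A n] by (auto simp: dom_eq[OF n])
  qed
  then show "openin Fell {A \<in> dom n. sh A n \<inter> U \<noteq> {}}"
    using open_hit open_comps open_degree_set n U by simp
next
  fix p K assume K: "compactin L K"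
  show "openin Fell {A \<in> dom n. sh A n \<inter> K = {}}"
  proof (subst openin_subopen, intro ballI)
    fix A0 assume "A0 \<in> {A \<in> dom n. sh A n \<inter> K = {}}"
    then obtain x0 where A0: "A0 \<in> paths" "x0 \<in> A0" "d x0 = n" "sh A0 n \<inter> K = {}"
      by (auto simp: dom_eq n)
    then have "x0 \<in> degree_set L d n" using path_arrows by (simp add: degree_set_def)
    then obtain G C where G: "openin L G" "compactin L C" "x0 \<in> G" "G \<subseteq> C" "C \<subseteq> degree_set L d n"
      using compact_nbhd[OF arrows_lc arrows_Hausdorff open_degree_set[OF n]] by metis
    have KL: "K \<subseteq> topspace L" using K compactin_subset_topspace by blast
    let ?T = "{A \<in> paths. A \<inter> G \<noteq> {}} \<inter> {A \<in> paths. A \<inter> comps C K = {}}"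
    have "openin Fell ?T"
      using G K by (intro openin_Int open_hit open_miss compact_comps)
    moreover have "A0 \<in> ?T"
    proof -
      \<comment> \<open>All arrows of \<open>C\<close> have degree \<open>n\<close>, so any such
        composite in \<open>A0\<close> puts \<open>y\<close> into the shift of
        \<open>A0\<close>.\<close>
      have False if "x \<in> C" "y \<in> K" "s x = r y" "c x y \<in> A0" for x y
      proof -
        have "y \<in> sh A0 n" using that G KL by (auto simp: shift_def degree_set_def)
        then show False using A0 that by blast
      qed
      then show ?thesis using A0 G by (auto simp: comps_def)
    qed
    moreover have "?T \<subseteq> {A \<in> dom n. sh A n \<inter> K = {}}"
    proof
      fix A assume "A \<in> ?T"
      then obtain x where A: "A \<in> paths" "x \<in> A" "x \<in> G" "A \<inter> comps C K = {}" by blast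
      then have x: "x \<in> C" "d x = n" using G by (auto simp: degree_set_def)
      have "sh A n = {y \<in> topspace L. s x = r y \<and> c x y \<in> A}"
        using shift_eq[OF A(1,2)] x by simp
      then have "sh A n \<inter> K = {}"
        using A x by (auto simp: comps_def)
      then show "A \<in> {A \<in> dom n. sh A n \<inter> K = {}}"
        using A x by (auto simp: dom_eq n)
    qed
    ultimately show "\<exists>T. openin Fell T \<and> A0 \<in> T \<and> T \<subseteq> {A \<in> dom n. sh A n \<inter> K = {}}"
      by blast
  qed
qed (use n open_dom shift_in_paths_dom in auto)

section \<open>Local sections of the source map and the local inverse of the shift\<close>

lemma local_section:
  assumes x0: "x0 \<in> topspace L"
  obtains G W g where "openin L G" "x0 \<in> G" "G \<subseteq> degree_set L d (d x0)" "openin V W" "s ` G \<subseteq> W"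
    and "continuous_map (subtopology V W) L g" "g ` W \<subseteq> G"
    and "\<And>v. v \<in> W \<Longrightarrow> s (g v) = v" "\<And>x. x \<in> G \<Longrightarrow> g (s x) = x"
proof -
  obtain U where U: "openin L U" "x0 \<in> U" "openin V (s ` U)"
    and "homeomorphic_map (subtopology L U) (subtopology V (s ` U)) s"
    using source_local_homeomorphism x0 unfolding local_homeomorphism_def by blast
  then obtain g where "homeomorphic_maps (subtopology L U) (subtopology V (s ` U)) s g"
    by (auto simp: homeomorphic_map_maps)
  moreover have "topspace (subtopology L U) = U" "topspace (subtopology V (s ` U)) = s ` U"
    using openin_subset[OF U(1)] openin_subset[OF U(3)] by auto
  ultimately have g: "continuous_map (subtopology V (s ` U)) (subtopology L U) g"
      "\<And>x. x \<in> U \<Longrightarrow> g (s x) = x" "\<And>v. v \<in> s ` U \<Longrightarrow> s (g v) = v"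
    by (auto simp: homeomorphic_maps_def)
  \<comment> \<open>Cutting down to one degree makes the section take values of that degree only.
    The source image stays open, being the preimage of \<open>?G\<close> under
    \<open>g\<close>.\<close>
  let ?G = "U \<inter> degree_set L d (d x0)"
  have G: "openin L ?G" using U open_degree_set degree_in_P x0 by auto
  have eq: "s ` ?G = {v \<in> topspace (subtopology V (s ` U)). g v \<in> ?G}"
    using g(2) openin_subset[OF U(3)] by force
  have cont: "continuous_map (subtopology V (s ` U)) L g"
    using g(1) continuous_map_in_subtopology by blast
  have "openin (subtopology V (s ` U)) (s ` ?G)"
    unfolding eq by (rule openin_continuous_map_preimage[OF cont G])
  then have W: "openin V (s ` ?G)"
    using openin_trans_full U(3) by blast
  show ?thesis
  proof (rule that[OF G _ _ W])
    show "continuous_map (subtopology V (s ` ?G)) L g"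
      by (rule continuous_map_from_subtopology_mono[OF cont]) auto
  qed (use x0 U g in \<open>auto simp: degree_set_def\<close>)
qed

lemma continuous_glue:
  assumes n: "n \<in> P" and W: "openin V W" and g: "continuous_map (subtopology V W) L g"
    and sec: "\<And>v. v \<in> W \<Longrightarrow> s (g v) = v" and deg: "\<And>v. v \<in> W \<Longrightarrow> d (g v) = n"
  defines "B0 \<equiv> {B \<in> paths. B \<inter> W \<noteq> {}}"
  shows "continuous_map (subtopology Fell B0) Fell (glue g)"
proof -
  have WV: "W \<subseteq> topspace V" using W openin_subset by blast
  have gL: "g v \<in> topspace L" if "v \<in> W" for v
    using continuous_map_image_subset_topspace[OF g] that WV by auto
  let ?R = "{b \<in> topspace L. r b \<in> W}"
  \<comment> \<open>Since \<open>g\<close> is evaluated at \<open>r b\<close>, this map does not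
    refer to a path, and it is continuous on the open set \<open>?R\<close>.\<close>
  let ?f = "\<lambda>b. c (g (r b)) b"
  have openR: "openin L ?R" by (rule openin_continuous_map_preimage[OF continuous_range W])
  have rR: "continuous_map (subtopology L ?R) (subtopology V W) r"
    by (intro continuous_map_into_subtopology continuous_map_from_subtopology continuous_range) auto
  have "continuous_map (subtopology L ?R) (prod_topology L L) (\<lambda>b. (g (r b), b))"
    using continuous_map_compose[OF rR g]
    by (intro continuous_map_pairedI) (auto simp: o_def continuous_map_from_subtopology)
  then have "continuous_map (subtopology L ?R) (subtopology (prod_topology L L) (composable L r s))
      (\<lambda>b. (g (r b), b))"
    by (rule continuous_map_into_subtopology) (auto simp: composable_def gL sec)
  from continuous_map_compose[OF this continuous_comp]
  have cf: "continuous_map (subtopology L ?R) L ?f" by (simp add: o_def)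
  have in_B0: "B \<in> B0" if "B \<in> paths" "b \<in> B" "r b \<in> W" for B b
    using that path_range unfolding B0_def by blast
  have B0_range: "r b \<in> W" "b \<in> topspace L" if "B \<in> B0" "b \<in> B" for B b
    using that path_vertex[of B b] WV path_arrows unfolding B0_def by auto
  have open_B0: "openin Fell B0"
    unfolding B0_def by (intro open_hit open_vertices W)
  show ?thesis
  proof (rule continuous_into_Fell[OF open_B0])
    fix B assume "B \<in> B0"
    then obtain v where "B \<in> paths" "v \<in> B" "v \<in> W" by (auto simp: B0_def)
    then show "glue g B \<in> paths"
      using glue_path(1)[of B v g] WV gL sec by blast
  next
    fix U assume U: "openin L U"
    \<comment> \<open>An element of \<open>U\<close> lies below \<open>?f b\<close> exactly when
      \<open>?f b\<close> belongs to the product of \<open>U\<close> with all arrows.\<close>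
    let ?H = "{b \<in> topspace (subtopology L ?R). ?f b \<in> comps U (topspace L)}"
    have "openin (subtopology L ?R) ?H"
      by (rule openin_continuous_map_preimage[OF cf open_comps[OF U openin_topspace]])
    then have H: "openin L ?H" using openR openin_trans_full by blast
    have "{B \<in> B0. glue g B \<inter> U \<noteq> {}} = {B \<in> paths. B \<inter> ?H \<noteq> {}}"
    proof (intro equalityI subsetI)
      fix B assume "B \<in> {B \<in> B0. glue g B \<inter> U \<noteq> {}}"
      then obtain u b where B: "B \<in> B0" "u \<in> U" "b \<in> B" "u \<preceq> ?f b"
        by (auto simp: glue_def)
      then have "b \<in> ?H"
        using B0_range[OF B(1,3)] unfolding path_le_def comps_def by auto
      then show "B \<in> {B \<in> paths. B \<inter> ?H \<noteq> {}}"
        using B by (auto simp: B0_def)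
    next
      fix B assume "B \<in> {B \<in> paths. B \<inter> ?H \<noteq> {}}"
      then obtain b u t where B: "B \<in> paths" "b \<in> B" "r b \<in> W"
        and u: "u \<in> U" "t \<in> topspace L" "s u = r t" "?f b = c u t"
        by (auto simp: comps_def)
      then have "u \<preceq> ?f b" using le_comp openin_subset[OF U] by auto
      then show "B \<in> {B \<in> B0. glue g B \<inter> U \<noteq> {}}"
        using in_B0[OF B] B u unfolding glue_def by blast
    qed
    then show "openin Fell {B \<in> B0. glue g B \<inter> U \<noteq> {}}"
      using open_hit[OF H] by simp
  next
    fix p K assume p: "p \<in> P" and K: "compactin L K" "K \<subseteq> degree_set L d p"
    have fb: "g (r b) \<preceq> ?f b" "d (?f b) = n \<otimes> d b" if "B \<in> B0" "b \<in> B" for B b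
      using B0_range[OF that] gL sec deg by (auto simp: le_comp comp_degree)
    show "openin Fell {B \<in> B0. glue g B \<inter> K = {}}"
    proof (cases "\<exists>k\<in>P. qle Q P n k \<and> qle Q P p k")
      \<comment> \<open>Any \<open>?f b\<close> above an element of \<open>K\<close> would have
        degree above both \<open>n\<close> and \<open>p\<close>, so here missing \<open>K\<close> is
        automatic.\<close>
      case False
      have "glue g B \<inter> K = {}" if B: "B \<in> B0" for B
      proof (rule ccontr)
        assume "glue g B \<inter> K \<noteq> {}"
        then obtain k b where k: "k \<in> K" "b \<in> B" "k \<preceq> ?f b" by (auto simp: glue_def)
        then have "qle Q P n (d (?f b))" "qle Q P p (d (?f b))" "d (?f b) \<in> P"
          using fb[OF B k(2)] le_degree le_arrows(2) degree_in_P deg B0_range[OF B k(2)] K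
          by (fastforce simp: degree_set_def)+
        then show False using False by blast
      qed
      then have "{B \<in> B0. glue g B \<inter> K = {}} = B0" by blast
      then show ?thesis using open_B0 by simp
    next
      case True
      then obtain l where l: "l \<in> P" "qle Q P n l" "qle Q P p l"
        and least: "\<And>k. k \<in> P \<Longrightarrow> qle Q P n k \<Longrightarrow> qle Q P p k \<Longrightarrow> qle Q P l k"
        using P_lub[OF n p] by metis
      obtain a q where a: "a \<in> P" "l = n \<otimes> a" and q: "q \<in> P" "l = p \<otimes> q"
        using l by (auto simp: qle_def)
      let ?N = "{y \<in> topspace L. r y \<in> s ` K \<and> d y = q}"
      have compN: "compactin L (comps K ?N)"
        by (intro compact_comps K compact_range_degree q image_compactin[OF _ continuous_source])
      then have closedN: "closedin L (comps K ?N)"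
        using arrows_Hausdorff compactin_imp_closedin by blast
      show ?thesis
      proof (subst openin_subopen, intro ballI)
        fix B1 assume "B1 \<in> {B \<in> B0. glue g B \<inter> K = {}}"
        then obtain v where B1: "B1 \<in> B0" "glue g B1 \<inter> K = {}" "v \<in> B1" "v \<in> W"
          by (auto simp: B0_def)
        obtain G C where G: "openin V G" "compactin V C" "v \<in> G" "G \<subseteq> C" "C \<subseteq> W"
          using compact_nbhd[OF vertices_lc vertices_Hausdorff W B1(4)] by metis
        \<comment> \<open>These are the arrows extending some \<open>g w\<close>, with
          \<open>w\<close> in \<open>C\<close>, to degree \<open>l\<close>.\<close>
        let ?M = "{y \<in> topspace L. r y \<in> C \<and> d y = a}"
        have M: "compactin (subtopology L ?R) ?M"
          using compact_range_degree[OF G(2) a(1)] G(5) by (auto simp: compactin_subtopology)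
        \<comment> \<open>The extensions \<open>b\<close> for which \<open>?f b\<close> has an
          initial segment in \<open>K\<close>. Near \<open>B1\<close>, missing this compact set
          forces the glued path to miss \<open>K\<close>.\<close>
        let ?K = "?M \<inter> {b \<in> topspace (subtopology L ?R). ?f b \<in> comps K ?N}"
        have "compactin (subtopology L ?R) ?K"
          by (intro compact_Int_closedin M closedin_continuous_map_preimage[OF cf] closedN)
        then have K': "compactin L ?K" by (simp add: compactin_subtopology)
        let ?T = "{B \<in> paths. B \<inter> G \<noteq> {}} \<inter> {B \<in> paths. B \<inter> ?K = {}}"
        have "openin Fell ?T"
          by (intro openin_Int open_hit open_miss K' open_vertices G)
        moreover have "B1 \<in> ?T"
        proof -
          have False if b: "b \<in> B1" "b \<in> ?K" for b
          proof -
            obtain k t where k: "k \<in> K" "t \<in> topspace L" "s k = r t" "?f b = c k t"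
              using b by (auto simp: comps_def)
            have "k \<in> topspace L" using k K by (auto simp: degree_set_def)
            then have "k \<preceq> ?f b" using k le_comp by auto
            then have "k \<in> glue g B1" using b by (auto simp: glue_def)
            then show False using B1 k by blast
          qed
          then show ?thesis using B1 G by (auto simp: B0_def)
        qed
        moreover have "?T \<subseteq> {B \<in> B0. glue g B \<inter> K = {}}"
        proof
          fix B assume "B \<in> ?T"
          then obtain w where B: "B \<in> paths" "B \<inter> ?K = {}" "w \<in> B" "w \<in> G" by blast
          then have "B \<in> B0" using G by (auto simp: B0_def)
          have "w \<in> topspace V" using B G WV by blast
          then have rw: "r b = w" if "b \<in> B" for b
            using path_vertex B that by blast
          \<comment> \<open>The segments of degree \<open>l\<close> below \<open>?f b\<close> that
            lie above \<open>k\<close> and above \<open>g (r b)\<close> coincide. Factoring this one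
            arrow in both ways yields \<open>b'\<close> below \<open>b\<close>, hence in
            \<open>B\<close>, and a remainder \<open>t\<close> in \<open>?N\<close>; so
            \<open>b'\<close> lies in the forbidden set \<open>?K\<close>.\<close>
          have False if k: "k \<in> K" "b \<in> B" "k \<preceq> ?f b" for k b
          proof -
            note fb' = fb[OF \<open>B \<in> B0\<close> k(2)] and b = B0_range[OF \<open>B \<in> B0\<close> k(2)]
            have dk: "d k = p" using k K by (auto simp: degree_set_def)
            have "qle Q P n (d (?f b))" "qle Q P p (d (?f b))"
              using le_degree[OF fb'(1)] le_degree[OF k(3)] deg[OF b(1)] dk by simp_all
            then have ld: "qle Q P l (d (?f b))"
              using least degree_in_P le_arrows(2)[OF k(3)] by blast
            obtain z where z: "k \<preceq> z" "z \<preceq> ?f b" "d z = l"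
              using segment[OF k(3) l(1) _ ld] l dk by metis
            obtain z' where z': "g (r b) \<preceq> z'" "z' \<preceq> ?f b" "d z' = l"
              using segment[OF fb'(1) l(1) _ ld] l deg[OF b(1)] by metis
            have "z' = z" using le_unique z z' by metis
            then obtain b' where b': "b' \<in> topspace L" "s (g (r b)) = r b'" "z = c (g (r b)) b'"
              using z' by (auto simp: path_le_def)
            have "b' \<preceq> b"
              using comp_le_cancel[OF gL[OF b(1)] b'(1,2) b(2)] sec[OF b(1)] z(2) b'(3) by simp
            then have "b' \<in> B" using path_hereditary B k by blast
            then have rb': "r b' = w" "r b = w" using rw k by auto
            have "n \<otimes> d b' = n \<otimes> a"
              using comp_degree[OF gL[OF b(1)] b'(1,2)] b'(3) z(3) deg[OF b(1)] a by simp
            then have "d b' = a"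
              using n a b' degree_in_P by (simp add: P_carrier)
            obtain t where t: "t \<in> topspace L" "s k = r t" "z = c k t"
              using z by (auto simp: path_le_def)
            have "p \<otimes> d t = p \<otimes> q"
              using comp_degree[of k t] t z dk q le_arrows(1)[OF k(3)] by simp
            then have "d t = q"
              using p q t degree_in_P by (simp add: P_carrier)
            have "r t \<in> s ` K" using t(2) k(1) by (metis imageI)
            then have "t \<in> ?N" using t \<open>d t = q\<close> by simp
            then have "z \<in> comps K ?N" using t k unfolding comps_def by blast
            then have "b' \<in> ?K"
              using b' rb' B G \<open>d b' = a\<close> by auto
            then show False using B \<open>b' \<in> B\<close> by blast
          qed
          then have "glue g B \<inter> K = {}" by (auto simp: glue_def)
          then show "B \<in> {B \<in> B0. glue g B \<inter> K = {}}"
            using \<open>B \<in> B0\<close> by blast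
        qed
        ultimately show "\<exists>T. openin Fell T \<and> B1 \<in> T \<and> T \<subseteq> {B \<in> B0. glue g B \<inter> K = {}}"
          by blast
      qed
    qed
  qed
qed

text \<open>With a section \<open>g\<close> through the arrow of degree \<open>n\<close> in
  \<open>A0\<close>, the shift and \<open>glue g\<close> are mutually inverse between the paths
  meeting \<open>G\<close> and the paths meeting \<open>W\<close>. Both sets are subbasic
  open.\<close>

lemma shift_local_homeo:
  assumes n: "n \<in> P" and A0: "A0 \<in> dom n"
  obtains U where "openin Fell U" "A0 \<in> U" "U \<subseteq> dom n" "openin Fell ((\<lambda>A. sh A n) ` U)"
    and "homeomorphic_map (subtopology Fell U) (subtopology Fell ((\<lambda>A. sh A n) ` U)) (\<lambda>A. sh A n)"
proof -
  obtain x0 where x0: "A0 \<in> paths" "x0 \<in> A0" "d x0 = n" using A0 by (auto simp: dom_eq n)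
  obtain G W g where G: "openin L G" "x0 \<in> G" "G \<subseteq> degree_set L d n" "openin V W" "s ` G \<subseteq> W"
    and g: "continuous_map (subtopology V W) L g" "g ` W \<subseteq> G"
      "\<And>v. v \<in> W \<Longrightarrow> s (g v) = v" "\<And>x. x \<in> G \<Longrightarrow> g (s x) = x"
    using local_section[OF path_arrows[OF x0(1,2)]] x0(3) by metis
  have WV: "W \<subseteq> topspace V" using G openin_subset by blast
  have gv: "g v \<in> topspace L" "d (g v) = n" if "v \<in> W" for v
    using g(2) G(3) that by (auto simp: degree_set_def)
  let ?U = "{A \<in> paths. A \<inter> G \<noteq> {}}" and ?B = "{B \<in> paths. B \<inter> W \<noteq> {}}"
  have openU: "openin Fell ?U" and openB: "openin Fell ?B"
    by (intro open_hit open_vertices G)+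
  have UD: "?U \<subseteq> dom n" using G by (auto simp: dom_hit n)
  \<comment> \<open>A path meeting \<open>G\<close> does so in its unique arrow of degree
    \<open>n\<close>, and there \<open>g\<close> undoes \<open>s\<close>.\<close>
  have shift: "sh A n \<in> ?B \<and> glue g (sh A n) = A" if "A \<in> ?U" for A
  proof -
    obtain x where x: "A \<in> paths" "x \<in> A" "x \<in> G" using \<open>A \<in> ?U\<close> by blast
    have dx: "d x = n" "x \<in> topspace L" using x G by (auto simp: degree_set_def)
    have "s x \<in> sh A (d x)"
      unfolding shift_eq[OF x(1,2)]
      using x dx by (simp add: source_vertex vertex_arrow vertex_ends unit_right)
    then show ?thesis
      using shift_path[OF x(1,2)] glue_shift[OF x(1,2)] g(4) x dx G by auto
  qed
  have glue: "glue g B \<in> ?U \<and> sh (glue g B) n = B" if "B \<in> ?B" for B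
  proof -
    obtain v where v: "B \<in> paths" "v \<in> B" "v \<in> W" using \<open>B \<in> ?B\<close> by blast
    have "v \<in> topspace V" using v WV by blast
    note glue_path[where g = g, OF v(1,2) this gv(1)[OF v(3)] g(3)[OF v(3)]]
    then show ?thesis using gv v g by auto
  qed
  have image: "(\<lambda>A. sh A n) ` ?U = ?B"
  proof
    show "(\<lambda>A. sh A n) ` ?U \<subseteq> ?B" using shift by blast
    show "?B \<subseteq> (\<lambda>A. sh A n) ` ?U" using glue by (metis (lifting) image_eqI subsetI)
  qed
  have top: "topspace (subtopology Fell ?U) = ?U" "topspace (subtopology Fell ?B) = ?B"
    using topspace_Fell by auto
  have "homeomorphic_maps (subtopology Fell ?U) (subtopology Fell ?B) (\<lambda>A. sh A n) (glue g)"
    unfolding homeomorphic_maps_def top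
  proof (intro conjI ballI)
    show "continuous_map (subtopology Fell ?U) (subtopology Fell ?B) (\<lambda>A. sh A n)"
      using shift top
      by (intro continuous_map_into_subtopology
          continuous_map_from_subtopology_mono[OF continuous_shift[OF n] UD]) auto
    have "continuous_map (subtopology Fell ?B) Fell (glue g)"
      by (rule continuous_glue[OF n G(4) g(1) g(3) gv(2)])
    then show "continuous_map (subtopology Fell ?B) (subtopology Fell ?U) (glue g)"
      using glue top by (intro continuous_map_into_subtopology) auto
  qed (use shift glue in auto)
  then have "homeomorphic_map (subtopology Fell ?U) (subtopology Fell ((\<lambda>A. sh A n) ` ?U)) (\<lambda>A. sh A n)"
    unfolding image by (rule homeomorphic_maps_map[THEN iffD1, THEN conjunct1])
  then show ?thesis
    using that[OF openU _ UD] x0 G openB image by auto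
qed

text \<open>The image of the domain is open because it is covered by the open images of the local
  neighbourhoods, which also serve as charts after restriction to domain and image.\<close>

lemma partial_local_homeomorphisms_shift:
  "by_partial_local_homeomorphisms P Fell (shift_domain P L r s c d) sh"
  unfolding by_partial_local_homeomorphisms_def act_V_def
proof (intro ballI conjI)
  fix n assume n: "n \<in> P"
  let ?f = "\<lambda>A. sh A n"
  show openD: "openin Fell (dom n)" using n by (rule open_dom)
  show "openin Fell (?f ` dom n)"
  proof (subst openin_subopen, intro ballI)
    fix B assume "B \<in> ?f ` dom n"
    then obtain A where A: "A \<in> dom n" "B = sh A n" by blast
    obtain U where "openin Fell (?f ` U)" "A \<in> U" "U \<subseteq> dom n"
      using shift_local_homeo[OF n A(1)] by metis
    then show "\<exists>T. openin Fell T \<and> B \<in> T \<and> T \<subseteq> ?f ` dom n" using A by blast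
  qed
  have top: "topspace (subtopology Fell (dom n)) = dom n"
    using openin_subset[OF openD] by auto
  show "local_homeomorphism (subtopology Fell (dom n)) (subtopology Fell (?f ` dom n)) ?f"
    unfolding local_homeomorphism_def top
  proof (intro conjI ballI)
    show "?f ` dom n \<subseteq> topspace (subtopology Fell (?f ` dom n))"
      using shift_in_paths_dom[OF n] topspace_Fell by auto
  next
    fix A assume "A \<in> dom n"
    then obtain U where U: "openin Fell U" "A \<in> U" "U \<subseteq> dom n" "openin Fell (?f ` U)"
      and h: "homeomorphic_map (subtopology Fell U) (subtopology Fell (?f ` U)) ?f"
      using shift_local_homeo[OF n] by metis
    have "?f ` U \<subseteq> ?f ` dom n" using U by blast
    with U h show "\<exists>U. openin (subtopology Fell (dom n)) U \<and> A \<in> U \<and>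
        openin (subtopology Fell (?f ` dom n)) (?f ` U) \<and>
        homeomorphic_map (subtopology (subtopology Fell (dom n)) U)
          (subtopology (subtopology Fell (?f ` dom n)) (?f ` U)) ?f"
      by (intro exI[of _ U])
        (simp add: subtopology_subtopology Int_absorb1 openin_subset_topspace_eq openin_subtopology_Int2
          subset_openin_subtopology)
  qed
qed

end

theorem theorem6p10:
  fixes Q :: "('q, 'z) monoid_scheme" and P :: "'q set"
    and L V :: "'a topology" and r s :: "'a \<Rightarrow> 'a" and c :: "'a \<Rightarrow> 'a \<Rightarrow> 'a" and d :: "'a \<Rightarrow> 'q"
  assumes "quasi_lattice_ordered Q P"
    and "topological_P_graph Q P L V r s c d"
    and "rd_proper P L V r d"
  shows "partial_action Q P (path_topology L r s c) (shift_domain P L r s c d) (shift L r s c d)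
       \<and> by_partial_local_homeomorphisms P (path_topology L r s c) (shift_domain P L r s c d) (shift L r s c d)
       \<and> directed_action Q P (path_topology L r s c) (shift_domain P L r s c d)"
proof -
  interpret proper_P_graph Q P L V r s c d
    by unfold_locales (fact assms)+
  show ?thesis
    using partial_action_shift partial_local_homeomorphisms_shift directed_action_shift by blast
qed

end
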